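(* Let $\psi(a,c,x)$ denote the Tricomi confluent hypergeometric function of the second kind. (i) If $a>0$, $c<1$ and $x>0$, then $$-\frac{a}{x^2}\psi^2(a,c,x)<\psi^2(a,c,x)-\psi(a,c-1,x)\psi(a,c+1,x).$$ (ii) If $a>1$, $c<-1$ and $x>0$, then $$\psi^2(a,c,x)-\psi(a,c-1,x)\psi(a,c+1,x)<\frac{a}{c(1+a-c)}\left(1+2x\left(\frac{c-a}{c(c+1)}\right)\right)\psi^2(a,c,x).$$ The inequality in (i) is sharp as $x\to\infty$, and the inequality in (ii) is sharp as $x\to 0$ (from the right), where "sharp" means that, after dividing by $\psi^2(a,c,x)$, the two sides of the inequality have the same finite limit as $x$ tends to the indicated endpoint.
   Context: For $a>0$, $c\in\mathbb{R}$ and $x>0$, $\psi(a,c,x)$ is the Tricomi confluent hypergeometric function of the second kind (often written $U(a,c,x)$), a particular solution of Kummer's differential equation $xy''(x)+(c-x)y'(x)-ay(x)=0$, given by $$\psi(a,c,x)=\frac{1}{\Gamma(a)}\int_{0}^{\infty}e^{-xt}t^{a-1}(1+t)^{c-a-1}\,dt.$$ Notation: $\psi^2(a,c,x)=(\psi(a,c,x))^2$. *)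

theory Defs
  imports "HOL-Analysis.Analysis"
begin

text \<open>
  The Tricomi confluent hypergeometric function of the second kind, given by its integral
  representation. The definition is meaningful only for \<open>a > 0\<close> and \<open>x > 0\<close>, where the integral
  converges absolutely for every real \<open>c\<close>.
\<close>
definition tricomi_psi :: "real \<Rightarrow> real \<Rightarrow> real \<Rightarrow> real" where
  "tricomi_psi a c x = 1 / Gamma a *
     (LINT t:{0<..}|lborel. exp (- x * t) * t powr (a - 1) * (1 + t) powr (c - a - 1))"

text \<open>
  Sharpness of an inequality \<open>l x < r x\<close> along the filter \<open>F\<close>: after division by the
  normalising function \<open>p\<close>, both sides tend to the same finite limit.
\<close>
definition sharp_at ::
  "real filter \<Rightarrow> (real \<Rightarrow> real) \<Rightarrow> (real \<Rightarrow> real) \<Rightarrow> (real \<Rightarrow> real) \<Rightarrow> bool" where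
  "sharp_at F p l r \<longleftrightarrow>
     (\<exists>L::real. ((\<lambda>x. l x / p x) \<longlongrightarrow> L) F \<and> ((\<lambda>x. r x / p x) \<longlongrightarrow> L) F)"

end

theory Submission
  imports Defs
begin

text \<open>
  Let \<open>I p q\<close> be the integral of \<open>exp (- x * t) * t powr p * (1 + t) powr q\<close> over \<open>t > 0\<close>. Up to
  the factor \<open>1 / Gamma a\<close>, the functions \<open>\<psi>(a, c, x)\<close> and \<open>\<psi>(a, c \<plusminus> 1, x)\<close> are \<open>I (a - 1) q\<close> and
  \<open>I (a - 1) (q \<plusminus> 1)\<close> with \<open>q = c - a - 1\<close>. Splitting off a factor \<open>1 + t\<close> and integrating by parts
  give linear relations between the \<open>I p q\<close>; through them the Turanian becomes a quadratic form in
  \<open>I a (q - 1)\<close>, \<open>I a q\<close>, \<open>I (a + 1) q\<close>, \<open>I (a + 2) q\<close>. Every bound then reduces to the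
  Cauchy-Schwarz inequality \<open>(I (p + 1) q)\<^sup>2 \<le> I p q * I (p + 2) q\<close>, and the constant in (ii) comes
  from \<open>(1 + y)\<^sup>2 * (1 - 2 * y) < 1\<close> for \<open>y > 0\<close>.
\<close>

section \<open>The kernel: shift rules and integrability\<close>

definition kummer_kernel :: "real \<Rightarrow> real \<Rightarrow> real \<Rightarrow> real \<Rightarrow> real" where
  "kummer_kernel x p q t = exp (- x * t) * t powr p * (1 + t) powr q"

text \<open>For \<open>p > -1\<close> and \<open>x > 0\<close> this is
  \<open>Gamma (p + 1) * tricomi_psi (p + 1) (p + q + 2) x\<close>. Keeping both exponents as
  parameters turns the relations between neighbouring Tricomi functions into unit shifts of
  \<open>p\<close> and \<open>q\<close>.\<close>

definition kummer_integral :: "real \<Rightarrow> real \<Rightarrow> real \<Rightarrow> real" where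
  "kummer_integral x p q = (LINT t:{0<..}|lborel. kummer_kernel x p q t)"

lemma kummer_kernel_measurable [measurable]: "kummer_kernel x p q \<in> borel_measurable borel"
  unfolding kummer_kernel_def by measurable

lemma kummer_kernel_pos: "t > 0 \<Longrightarrow> kummer_kernel x p q t > 0"
  by (simp add: kummer_kernel_def)

lemma kummer_kernel_Suc_left:
  "t > 0 \<Longrightarrow> kummer_kernel x (p + 1) q t = t * kummer_kernel x p q t"
  by (simp add: kummer_kernel_def powr_add)

lemma kummer_kernel_Suc_right:
  "t > 0 \<Longrightarrow> kummer_kernel x p (q + 1) t = (1 + t) * kummer_kernel x p q t"
  by (simp add: kummer_kernel_def powr_add)

text \<open>Apply \<open>ln z \<le> z - 1\<close> at \<open>z = e * (1 + t)\<close> and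
  exponentiate. The free rate \<open>\<delta>\<close> lets a power of either sign be absorbed into
  part of the decay \<open>exp (- x * t)\<close>.\<close>

lemma one_plus_powr_le_exp:
  fixes q \<delta> :: real
  assumes "\<delta> > 0"
  obtains C where "C > 0" "\<And>t. t > 0 \<Longrightarrow> (1 + t) powr q \<le> C * exp (\<delta> * t)"
proof -
  \<comment> \<open>The \<open>+ 1\<close> keeps the denominator positive at \<open>q = 0\<close>
    and still gives \<open>\<bar>q\<bar> * e \<le> \<delta>\<close>.\<close>
  define e where "e = \<delta> / (\<bar>q\<bar> + 1)"
  have e: "e > 0" "\<bar>q\<bar> * e \<le> \<delta>"
    using assms by (auto simp: e_def field_simps mult_nonneg_nonneg)
  have "(1 + t) powr q \<le> exp (\<bar>q\<bar> * (e - ln e)) * exp (\<delta> * t)" if t: "t > 0" for t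
  proof -
    have "ln (1 + t) + ln e \<le> e * (1 + t)"
      using ln_le_minus_one[of "e * (1 + t)"] e t by (simp add: ln_mult)
    have "q * ln (1 + t) \<le> \<bar>q\<bar> * ln (1 + t)"
      using t by (intro mult_right_mono) auto
    also have "\<dots> \<le> \<bar>q\<bar> * (e * (1 + t) - ln e)"
      using \<open>ln (1 + t) + ln e \<le> e * (1 + t)\<close> by (intro mult_left_mono) auto
    also have "\<dots> = \<bar>q\<bar> * (e - ln e) + \<bar>q\<bar> * e * t"
      by (simp add: algebra_simps)
    also have "\<dots> \<le> \<bar>q\<bar> * (e - ln e) + \<delta> * t"
      using e t by (intro add_left_mono mult_right_mono) auto
    finally show ?thesis
      using t by (simp add: powr_def exp_add[symmetric])
  qed
  then show ?thesis
    using that[of "exp (\<bar>q\<bar> * (e - ln e))"] by simp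
qed

text \<open>Half of the exponential decay absorbs \<open>(1 + t) powr q\<close>; what is left is a
  Gamma integrand with rate \<open>x / 2\<close>, integrable near 0 because
  \<open>p > -1\<close>.\<close>

lemma kummer_kernel_integrable:
  assumes "p > -1" "x > 0"
  shows "set_integrable lborel {0<..} (kummer_kernel x p q)"
proof -
  obtain C where C: "C > 0" "\<And>t. t > 0 \<Longrightarrow> (1 + t) powr q \<le> C * exp (x / 2 * t)"
    using one_plus_powr_le_exp[of "x / 2" q] assms by auto
  \<comment> \<open>The Gamma integrand enters as a complex function; on the positive reals its norm
    is the real integrand.\<close>
  have "(\<lambda>t. norm (complex_of_real t powr (of_real (p + 1) - 1) / of_real (exp (x / 2 * t))))
      absolutely_integrable_on {0<..}"
    using absolutely_integrable_Gamma_integral[of "of_real (p + 1)" "x / 2"] assms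
    by (intro absolutely_integrable_norm[unfolded o_def]) auto
  then have "set_integrable lebesgue {0<..} (\<lambda>t. t powr p * exp (- (x / 2 * t)))"
    by (rule set_integrable_cong[THEN iffD1, rotated -1])
      (auto simp: norm_divide norm_powr_real_powr exp_minus field_simps)
  \<comment> \<open>Borel measurability allows the passage from Lebesgue measure to
    \<open>lborel\<close>, of which it is the completion.\<close>
  then have "set_integrable lborel {0<..} (\<lambda>t. t powr p * exp (- (x / 2 * t)))"
    unfolding set_integrable_def by (subst (asm) integrable_completion) auto
  then have "set_integrable lborel {0<..} (\<lambda>t. C * (t powr p * exp (- (x / 2 * t))))"
    by (intro set_integrable_mult_right)
  then show ?thesis
  proof (rule set_integrable_bound)
    show "set_borel_measurable lborel {0<..} (kummer_kernel x p q)"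
      unfolding set_borel_measurable_def by measurable
    show "AE t in lborel. t \<in> {0<..} \<longrightarrow> norm (kummer_kernel x p q t)
        \<le> norm (C * (t powr p * exp (- (x / 2 * t))))"
    proof (intro AE_I2 impI)
      fix t :: real assume "t \<in> {0<..}"
      then have t: "t > 0" by simp
      have "kummer_kernel x p q t \<le> exp (- x * t) * t powr p * (C * exp (x / 2 * t))"
        unfolding kummer_kernel_def using C(2)[OF t] by (intro mult_left_mono) auto
      also have "\<dots> = C * (t powr p * (exp (- x * t) * exp (x / 2 * t)))"
        by (simp add: mult_ac)
      also have "exp (- x * t) * exp (x / 2 * t) = exp (- (x / 2 * t))"
        by (simp add: exp_add[symmetric])
      finally show "norm (kummer_kernel x p q t) \<le> norm (C * (t powr p * exp (- (x / 2 * t))))"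
        using kummer_kernel_pos[OF t, of x p q] C(1) by (simp add: abs_mult)
    qed
  qed
qed

section \<open>Positivity, splitting and Cauchy-Schwarz for the integrals\<close>

lemma kummer_integral_pos:
  assumes "p > -1" "x > 0"
  shows "kummer_integral x p q > 0"
proof -
  let ?f = "\<lambda>t. indicator {0<..} t *\<^sub>R kummer_kernel x p q t"
  have int: "integrable lborel ?f"
    using kummer_kernel_integrable[OF assms] by (simp add: set_integrable_def)
  have nn: "?f t \<ge> 0" for t
    using kummer_kernel_pos[of t x p q] by (auto simp: indicator_def)
  have "integral\<^sup>L lborel ?f \<noteq> 0"
  proof
    assume "integral\<^sup>L lborel ?f = 0"
    then have "AE t in lborel. ?f t = 0"
      using integral_nonneg_eq_0_iff_AE[OF int] nn by auto
    \<comment> \<open>The integrand is strictly positive on the interval from 0 to 1, which has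
      measure 1, so it cannot vanish almost everywhere.\<close>
    then have "AE t in lborel. t \<notin> {0<..<1::real}"
      by eventually_elim (use kummer_kernel_pos[of _ x p q] in \<open>force simp: indicator_def\<close>)
    then have "emeasure lborel {0<..<1::real} = 0"
      by (intro AE_iff_measurable[THEN iffD1, rotated 2]) auto
    then show False by simp
  qed
  moreover have "integral\<^sup>L lborel ?f \<ge> 0"
    using nn by (intro integral_nonneg_AE) auto
  ultimately show ?thesis
    by (simp add: kummer_integral_def set_lebesgue_integral_def)
qed

lemma kummer_integral_Suc_right:
  assumes "p > -1" "x > 0"
  shows "kummer_integral x p (q + 1) = kummer_integral x p q + kummer_integral x (p + 1) q"
proof -
  have "kummer_integral x p (q + 1)
      = (LINT t:{0<..}|lborel. kummer_kernel x p q t + kummer_kernel x (p + 1) q t)"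
    unfolding kummer_integral_def
    by (intro set_lebesgue_integral_cong)
      (auto simp: kummer_kernel_Suc_left kummer_kernel_Suc_right ring_distribs)
  also have "\<dots> = kummer_integral x p q + kummer_integral x (p + 1) q"
    unfolding kummer_integral_def
    by (intro set_integral_add kummer_kernel_integrable) (use assms in auto)
  finally show ?thesis .
qed

text \<open>Integrating the nonnegative \<open>(t - s)^2\<close> against the kernel gives a
  quadratic in \<open>s\<close>; nonnegativity of its minimum is the claim.\<close>

lemma kummer_integral_Turan:
  assumes "p > -1" "x > 0"
  shows "(kummer_integral x (p + 1) q)\<^sup>2 \<le> kummer_integral x p q * kummer_integral x (p + 2) q"
proof -
  define I0 I1 I2 where "I0 = kummer_integral x p q" and "I1 = kummer_integral x (p + 1) q"
    and "I2 = kummer_integral x (p + 2) q"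
  have "I0 > 0" unfolding I0_def using assms by (rule kummer_integral_pos)
  \<comment> \<open>The minimiser of \<open>I2 - 2 * s * I1 + s^2 * I0\<close>, that is, the mean of
    \<open>t\<close> under the kernel.\<close>
  define s where "s = I1 / I0"
  have int: "set_integrable lborel {0<..} (kummer_kernel x (p + 2) q)"
    "set_integrable lborel {0<..} (kummer_kernel x (p + 1) q)"
    "set_integrable lborel {0<..} (kummer_kernel x p q)"
    using assms by (auto intro!: kummer_kernel_integrable)
  have "0 \<le> (LINT t:{0<..}|lborel. (t - s)\<^sup>2 * kummer_kernel x p q t)"
    unfolding set_lebesgue_integral_def
    by (intro integral_nonneg_AE AE_I2)
      (auto simp: indicator_def intro!: mult_nonneg_nonneg less_imp_le[OF kummer_kernel_pos])
  also have "\<dots> = (LINT t:{0<..}|lborel. (kummer_kernel x (p + 2) q t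
      - 2 * s * kummer_kernel x (p + 1) q t) + s\<^sup>2 * kummer_kernel x p q t)"
  proof (intro set_lebesgue_integral_cong allI impI)
    fix t :: real assume "t \<in> {0<..}"
    then have "kummer_kernel x (p + 1) q t = t * kummer_kernel x p q t"
      "kummer_kernel x (p + 2) q t = t * (t * kummer_kernel x p q t)"
      using kummer_kernel_Suc_left[of t x p q] kummer_kernel_Suc_left[of t x "p + 1" q]
      by (simp_all add: add.assoc)
    then show "(t - s)\<^sup>2 * kummer_kernel x p q t = (kummer_kernel x (p + 2) q t
      - 2 * s * kummer_kernel x (p + 1) q t) + s\<^sup>2 * kummer_kernel x p q t"
      by (simp add: power2_eq_square algebra_simps)
  qed auto
  also have "\<dots> = I2 - 2 * s * I1 + s\<^sup>2 * I0"
    unfolding I0_def I1_def I2_def kummer_integral_def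
    using int by (simp add: set_integral_add set_integral_diff)
  also have "\<dots> = I2 - I1\<^sup>2 / I0"
    using \<open>I0 > 0\<close> by (simp add: s_def power2_eq_square field_simps)
  finally show ?thesis
    using \<open>I0 > 0\<close> by (simp add: I0_def I1_def I2_def field_simps)
qed

section \<open>Boundary terms and integration by parts\<close>

lemma kummer_kernel_tendsto_at_right_0:
  assumes "p > 0"
  shows "(kummer_kernel x p q \<longlongrightarrow> 0) (at_right 0)"
proof -
  have "((\<lambda>t. exp (- x * t) * t powr p * (1 + t) powr q)
      \<longlongrightarrow> exp (- x * 0) * 0 powr p * (1 + 0) powr q) (at_right 0)"
    using assms by (intro tendsto_intros tendsto_powr' ) (auto simp: eventually_at_filter)
  then show ?thesis
    using assms by (simp add: kummer_kernel_def[abs_def])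
qed

text \<open>Since \<open>p \<ge> 0\<close>, \<open>t powr p\<close> is at most
  \<open>(1 + t) powr p\<close>; the joint power \<open>(1 + t) powr (p + q)\<close> is then
  absorbed by half of the decay.\<close>

lemma kummer_kernel_tendsto_at_top:
  assumes "p \<ge> 0" "x > 0"
  shows "(kummer_kernel x p q \<longlongrightarrow> 0) at_top"
proof -
  obtain C where C: "\<And>t. t > 0 \<Longrightarrow> (1 + t) powr (p + q) \<le> C * exp (x / 2 * t)"
    using one_plus_powr_le_exp[of "x / 2" "p + q"] assms by auto
  have bound: "kummer_kernel x p q t \<le> C * exp (- (x / 2 * t))" if t: "t > 0" for t
  proof -
    have "kummer_kernel x p q t \<le> exp (- x * t) * (1 + t) powr p * (1 + t) powr q"
      unfolding kummer_kernel_def using t assms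
      by (intro mult_right_mono mult_left_mono powr_mono2) auto
    also have "\<dots> \<le> exp (- x * t) * (C * exp (x / 2 * t))"
      using C[OF t] by (simp add: powr_add mult.assoc)
    also have "\<dots> = C * (exp (- x * t) * exp (x / 2 * t))"
      by simp
    also have "exp (- x * t) * exp (x / 2 * t) = exp (- (x / 2 * t))"
      by (simp add: exp_add[symmetric])
    finally show ?thesis .
  qed
  have "filterlim (\<lambda>t. - (x / 2 * t)) at_bot at_top"
    using assms by (intro filterlim_compose[OF filterlim_uminus_at_bot_at_top]
        filterlim_tendsto_pos_mult_at_top[OF tendsto_const _ filterlim_ident]) auto
  then have "((\<lambda>t. C * exp (- (x / 2 * t))) \<longlongrightarrow> C * 0) at_top"
    by (intro tendsto_intros filterlim_compose[OF exp_at_bot])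
  then have lim: "((\<lambda>t. C * exp (- (x / 2 * t))) \<longlongrightarrow> 0) at_top"
    by simp
  show ?thesis
  proof (rule tendsto_sandwich[OF _ _ tendsto_const lim])
    show "\<forall>\<^sub>F t in at_top. 0 \<le> kummer_kernel x p q t"
      using eventually_gt_at_top[of 0] by eventually_elim (simp add: kummer_kernel_pos less_imp_le)
    show "\<forall>\<^sub>F t in at_top. kummer_kernel x p q t \<le> C * exp (- (x / 2 * t))"
      using eventually_gt_at_top[of 0] by eventually_elim (rule bound)
  qed
qed

text \<open>Integrate the derivative of \<open>kummer_kernel x p q\<close> over the half-line; both
  boundary limits vanish. The hypothesis \<open>p > 0\<close> removes the one at 0 and makes the
  term with exponent \<open>p - 1\<close> integrable.\<close>

lemma kummer_integral_by_parts:
  assumes "p > 0" "x > 0"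
  shows "x * kummer_integral x p q = p * kummer_integral x (p - 1) q + q * kummer_integral x p (q - 1)"
proof -
  let ?f' = "\<lambda>t. (p * kummer_kernel x (p - 1) q t + q * kummer_kernel x p (q - 1) t)
      - x * kummer_kernel x p q t"
  have int: "set_integrable lborel {0<..} (kummer_kernel x (p - 1) q)"
    "set_integrable lborel {0<..} (kummer_kernel x p (q - 1))"
    "set_integrable lborel {0<..} (kummer_kernel x p q)"
    using assms by (auto intro!: kummer_kernel_integrable)
  \<comment> \<open>The fundamental theorem is used with extended real bounds, so the ends enter
    only as one-sided limits and no derivative at 0 is needed.\<close>
  have ei: "einterval 0 \<infinity> = {0::real<..}"
    by (auto simp: einterval_def zero_ereal_def)
  have "(LBINT t=0..\<infinity>. ?f' t) = 0 - 0"
  proof (rule interval_integral_FTC_integrable[where F = "kummer_kernel x p q"])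
    fix t :: real assume "0 < ereal t"
    then have t: "t > 0" by simp
    have "((\<lambda>t. exp (- x * t)) has_real_derivative - x * exp (- x * t)) (at t)"
      by (auto intro!: derivative_eq_intros)
    moreover have "((\<lambda>t. t powr p) has_real_derivative p * t powr (p - 1)) (at t)"
      using t by (rule has_real_derivative_powr)
    moreover have "((\<lambda>t. (1 + t) powr q) has_real_derivative q * (1 + t) powr (q - 1)) (at t)"
      using DERIV_chain2[where f = "\<lambda>z. z powr q" and g = "(+) 1" and x = t and Db = 1]
        has_real_derivative_powr[of "1 + t" q] t
      by (auto intro!: derivative_eq_intros)
    ultimately have "((\<lambda>t. exp (- x * t) * t powr p * (1 + t) powr q) has_real_derivative
        (- x * exp (- x * t) * t powr p + p * t powr (p - 1) * exp (- x * t)) * (1 + t) powr q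
        + q * (1 + t) powr (q - 1) * (exp (- x * t) * t powr p)) (at t)"
      by (intro DERIV_mult)
    then have "(kummer_kernel x p q has_real_derivative ?f' t) (at t)"
      unfolding kummer_kernel_def[abs_def] by (simp add: algebra_simps)
    then show "(kummer_kernel x p q has_vector_derivative ?f' t) (at t)"
      by (simp add: has_real_derivative_iff_has_vector_derivative)
    show "isCont ?f' t"
      unfolding kummer_kernel_def using t by (intro continuous_intros) auto
  next
    show "set_integrable lborel (einterval 0 \<infinity>) ?f'"
      unfolding ei using int by (intro set_integral_add set_integral_diff set_integrable_mult_right)
  next
    show "((kummer_kernel x p q \<circ> real_of_ereal) \<longlongrightarrow> 0) (at_right 0)"
      using kummer_kernel_tendsto_at_right_0[OF assms(1)]
      by (simp add: zero_ereal_def ereal_tendsto_simps del: ereal_eq_0)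
    show "((kummer_kernel x p q \<circ> real_of_ereal) \<longlongrightarrow> 0) (at_left \<infinity>)"
      using kummer_kernel_tendsto_at_top[of p x q] assms
      by (simp add: ereal_tendsto_simps)
  qed simp
  moreover have "(LBINT t=0..\<infinity>. ?f' t) = p * kummer_integral x (p - 1) q
      + q * kummer_integral x p (q - 1) - x * kummer_integral x p q"
    unfolding kummer_integral_def interval_lebesgue_integral_def ei
    using int by (simp add: set_integral_add set_integral_diff)
  ultimately show ?thesis by simp
qed

section \<open>Reduction to algebraic relations between five integrals\<close>

lemma tricomi_psi_eq_kummer_integral:
  "tricomi_psi a c x = kummer_integral x (a - 1) (c - a - 1) / Gamma a"
  by (simp add: tricomi_psi_def kummer_integral_def kummer_kernel_def)

text \<open>Packs the analysis into relations between real numbers, so that the bounds become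
  algebra. With \<open>q = c - a - 1\<close>, the three moment inequalities are Cauchy-Schwarz at
  \<open>(a - 1, q - 1)\<close>, \<open>(a, q - 1)\<close> and \<open>(a, q)\<close>; the three
  equations are integration by parts at \<open>(a, q)\<close>, \<open>(a + 1, q)\<close> and
  \<open>(a + 1, q + 1)\<close>.\<close>

lemma tricomi_psi_moments:
  fixes a c x :: real
  assumes a: "a > 0" and x: "x > 0"
  obtains g F J0 J M N where "g > 0" "F > 0" "J0 > 0" "J0 < J" "M > 0"
    "tricomi_psi a c x = g * F" "tricomi_psi a (c - 1) x = g * (F - J0)"
    "tricomi_psi a (c + 1) x = g * (F + J)"
    "J0 * J \<le> F * (J - J0)" "J\<^sup>2 \<le> J0 * (J + M)" "M\<^sup>2 \<le> J * N"
    "a * F = x * J + (1 + a - c) * J0"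
    "x * M = (a + 1) * J - (1 + a - c) * (J - J0)"
    "x * (M + N) = (a + 1) * J + (c + 1) * M"
proof -
  define q where "q = c - a - 1"
  define I where "I = kummer_integral x"
  have pos: "I p r > 0" if "p > -1" for p r
    unfolding I_def using that x by (rule kummer_integral_pos)
  have rec: "I p (r + 1) = I p r + I (p + 1) r" if "p > -1" for p r
    unfolding I_def using that x by (rule kummer_integral_Suc_right)
  have turan: "(I (p + 1) r)\<^sup>2 \<le> I p r * I (p + 2) r" if "p > -1" for p r
    unfolding I_def using that x by (rule kummer_integral_Turan)
  have ibp: "x * I p r = p * I (p - 1) r + r * I p (r - 1)" if "p > 0" for p r
    unfolding I_def using that x by (rule kummer_integral_by_parts)
  define F J0 J M N where "F = I (a - 1) q" and "J0 = I a (q - 1)" and "J = I a q"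
    and "M = I (a + 1) q" and "N = I (a + 2) q"
  \<comment> \<open>Splitting off \<open>1 + t\<close> expresses every other integral that occurs
    through these five.\<close>
  have F0: "I (a - 1) (q - 1) = F - J0" and F1: "I (a - 1) (q + 1) = F + J"
    and K: "I (a + 1) (q - 1) = J - J0" and L: "I (a + 2) (q - 1) = M - (J - J0)"
    and J1: "I a (q + 1) = J + M" and M1: "I (a + 1) (q + 1) = M + N"
    using rec[of "a - 1" "q - 1"] rec[of "a - 1" q] rec[of a "q - 1"] rec[of "a + 1" "q - 1"]
      rec[of a q] rec[of "a + 1" q] a
    by (simp_all add: F_def J0_def J_def M_def N_def add.assoc)
  show thesis
  proof
    show "inverse (Gamma a) > 0"
      using a by (simp add: Gamma_real_pos)
    show "F > 0" "J0 > 0" "M > 0"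
      unfolding F_def J0_def M_def using a by (auto intro!: pos)
    show "J0 < J"
      using pos[of "a + 1" "q - 1"] K a by simp
    show "tricomi_psi a c x = inverse (Gamma a) * F"
      by (simp add: tricomi_psi_eq_kummer_integral F_def I_def q_def field_simps)
    have "c - 1 - a - 1 = q - 1" "c + 1 - a - 1 = q + 1"
      by (simp_all add: q_def)
    then show "tricomi_psi a (c - 1) x = inverse (Gamma a) * (F - J0)"
      "tricomi_psi a (c + 1) x = inverse (Gamma a) * (F + J)"
      by (simp_all only: tricomi_psi_eq_kummer_integral F0[symmetric] F1[symmetric] I_def
          divide_inverse mult.commute)
    show "J0 * J \<le> F * (J - J0)"
    proof -
      have "a - 1 + 1 = a" "a - 1 + 2 = a + 1" "- 1 < a - 1" using a by simp_all
      then have "J0\<^sup>2 \<le> (F - J0) * (J - J0)"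
        using turan[of "a - 1" "q - 1"] by (simp only: F0 K J0_def[symmetric])
      then show ?thesis
        by (simp add: power2_eq_square algebra_simps)
    qed
    show "J\<^sup>2 \<le> J0 * (J + M)"
    proof -
      have "(J - J0)\<^sup>2 \<le> J0 * (M - (J - J0))"
        using turan[of a "q - 1"] a unfolding K L J0_def[symmetric] by simp
      then show ?thesis
        by (simp add: power2_eq_square algebra_simps)
    qed
    show "M\<^sup>2 \<le> J * N"
      using turan[of a q] a by (simp add: J_def M_def N_def)
    show "a * F = x * J + (1 + a - c) * J0"
      using ibp[of a q] a unfolding F_def J_def J0_def by (simp add: q_def algebra_simps)
    show "x * M = (a + 1) * J - (1 + a - c) * (J - J0)"
      using ibp[of "a + 1" q] a unfolding K M_def[symmetric]
      by (simp add: J_def[symmetric]) (simp add: q_def algebra_simps)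
    show "x * (M + N) = (a + 1) * J + (c + 1) * M"
      using ibp[of "a + 1" "q + 1"] a unfolding M1
      by (simp add: J1 M_def[symmetric]) (simp add: q_def algebra_simps)
  qed
qed

section \<open>Bounds for the Turanian\<close>

definition turanian :: "real \<Rightarrow> real \<Rightarrow> real \<Rightarrow> real" where
  "turanian a c x = (tricomi_psi a c x)\<^sup>2 - tricomi_psi a (c - 1) x * tricomi_psi a (c + 1) x"

lemma tricomi_psi_pos: "a > 0 \<Longrightarrow> x > 0 \<Longrightarrow> tricomi_psi a c x > 0"
  by (rule tricomi_psi_moments[of a x c]) auto

text \<open>The first moment inequality fixes the sign. This is the upper side of the squeeze as
  \<open>x\<close> tends to infinity.\<close>

lemma turanian_nonpos:
  assumes "a > 0" "x > 0"
  shows "turanian a c x \<le> 0"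
proof (rule tricomi_psi_moments[OF assms, of c])
  fix g F J0 J :: real
  assume "g > 0" and psi: "tricomi_psi a c x = g * F" "tricomi_psi a (c - 1) x = g * (F - J0)"
    "tricomi_psi a (c + 1) x = g * (F + J)"
    and *: "J0 * J \<le> F * (J - J0)"
  have "turanian a c x = g\<^sup>2 * (J0 * J - F * (J - J0))"
    unfolding turanian_def psi by (simp add: power2_eq_square algebra_simps)
  then show ?thesis
    using * by (simp add: mult_nonneg_nonpos)
qed

text \<open>The chain is \<open>a * (- D) \<le> J0 * J < J^2 \<le> (a * F / x)^2\<close>, where
  \<open>D\<close> is the Turanian without the factor \<open>g^2\<close>.\<close>

lemma turanian_gt:
  assumes "a > 0" "c < 1" "x > 0"
  shows "- (a / x\<^sup>2) * (tricomi_psi a c x)\<^sup>2 < turanian a c x"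
proof (rule tricomi_psi_moments[OF assms(1,3), of c])
  fix g F J0 J M :: real
  assume "g > 0" and pos: "J0 > 0" "J0 < J"
    and psi: "tricomi_psi a c x = g * F" "tricomi_psi a (c - 1) x = g * (F - J0)"
      "tricomi_psi a (c + 1) x = g * (F + J)"
    and turan: "J\<^sup>2 \<le> J0 * (J + M)"
    and F: "a * F = x * J + (1 + a - c) * J0"
    and M: "x * M = (a + 1) * J - (1 + a - c) * (J - J0)"
  define D where "D = J0 * J - F * (J - J0)"
  have D: "turanian a c x = g\<^sup>2 * D"
    unfolding turanian_def psi by (simp add: D_def power2_eq_square algebra_simps)
  \<comment> \<open>The factor \<open>x\<close> makes room for the equation for
    \<open>x * M\<close>; after substitution the terms with \<open>x\<close> and with
    \<open>1 + a - c\<close> cancel and only \<open>J0 * J\<close> survives.\<close>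
  have "x * J\<^sup>2 \<le> J0 * (x * J + x * M)"
    using mult_left_mono[OF turan, of x] assms by (simp add: algebra_simps)
  moreover have "a * (- D) = (a * F) * (J - J0) - a * (J0 * J)"
    by (simp add: D_def algebra_simps)
  ultimately have "a * (- D) \<le> J0 * J"
    unfolding F M by (simp add: power2_eq_square algebra_simps)
  then have "a * (- D) * x\<^sup>2 \<le> (J0 * J) * x\<^sup>2"
    by (intro mult_right_mono) auto
  also have "\<dots> < (J * J) * x\<^sup>2"
    using pos assms by (intro mult_strict_right_mono) auto
  \<comment> \<open>Here \<open>c < 1\<close> and \<open>a > 0\<close> make \<open>1 + a - c\<close>
    positive, so \<open>x * J \<le> a * F\<close>.\<close>
  also have "\<dots> \<le> (a * F)\<^sup>2"
    unfolding F using pos assms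
    by (subst power2_eq_square[symmetric], subst power_mult_distrib[symmetric])
      (intro power_mono, auto simp: mult.commute)
  finally have "a * (- D * x\<^sup>2) < a * (a * F\<^sup>2)"
    by (simp add: power2_eq_square algebra_simps)
  then have "- D * x\<^sup>2 < a * F\<^sup>2"
    using assms by (simp only: mult_less_cancel_left_pos)
  then have "- (a / x\<^sup>2) * F\<^sup>2 < D"
    using assms by (simp add: field_simps)
  then have "g\<^sup>2 * (- (a / x\<^sup>2) * F\<^sup>2) < g\<^sup>2 * D"
    using \<open>g > 0\<close> by (intro mult_strict_left_mono) auto
  then show ?thesis
    unfolding psi D by (simp add: power_mult_distrib mult_ac)
qed

text \<open>The factor 2 cancels the linear term of the square, so the deviation from 1 starts at
  second order with a negative sign.\<close>

lemma cubic_less_one: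
  fixes y :: real
  assumes "y > 0"
  shows "(1 + y)\<^sup>2 * (1 - 2 * y) < 1"
proof -
  have "(1 + y)\<^sup>2 * (1 - 2 * y) = 1 - (3 * y\<^sup>2 + 2 * y ^ 3)"
    by (simp add: power2_eq_square power3_eq_cube algebra_simps)
  moreover have "3 * y\<^sup>2 + 2 * y ^ 3 > 0"
    using assms by (intro add_pos_pos) auto
  ultimately show ?thesis by simp
qed

text \<open>Both bounds come from one identity for \<open>a * v * (- D)\<close> with leading term
  \<open>b * J^2\<close>, and from comparing \<open>a * F\<close> with \<open>b * J\<close> in both
  directions. The lower bound has the same value at \<open>x = 0\<close> as the upper one and serves
  the sharpness there.\<close>

lemma turanian_bounds:
  assumes a: "a > 0" and c: "c < -1" and x: "x > 0"
  shows "turanian a c x < a / (c * (1 + a - c)) * (1 + 2 * x * ((c - a) / (c * (c + 1))))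
      * (tricomi_psi a c x)\<^sup>2" (is ?upper)
    and "a / (c * (1 + a - c)) * (1 - x * ((a + 1) / c)) * (tricomi_psi a c x)\<^sup>2
      \<le> turanian a c x" (is ?lower)
proof -
  obtain g F J0 J M N where g: "g > 0" and pos: "F > 0" "J0 > 0" "J0 < J" "M > 0"
    and psi: "tricomi_psi a c x = g * F" "tricomi_psi a (c - 1) x = g * (F - J0)"
      "tricomi_psi a (c + 1) x = g * (F + J)"
    and turan: "M\<^sup>2 \<le> J * N"
    and F: "a * F = x * J + (1 + a - c) * J0"
    and M: "x * M = (a + 1) * J - (1 + a - c) * (J - J0)"
    and N: "x * (M + N) = (a + 1) * J + (c + 1) * M"
    using tricomi_psi_moments[OF a x, of c] by metis
  define b v D where "b = - c" and "v = 1 + a - c" and "D = J0 * J - F * (J - J0)"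
  have D: "turanian a c x = g\<^sup>2 * D"
    unfolding turanian_def psi by (simp add: D_def power2_eq_square algebra_simps)
  have b: "b > 1" and v: "v > 0" and J: "J > 0"
    using a c pos by (auto simp: b_def v_def)
  have vJ0: "v * J0 = b * J + x * M"
    using M by (simp add: b_def v_def algebra_simps)
  have aF: "a * F = b * J + x * (J + M)"
    using F vJ0 by (simp add: v_def algebra_simps)
  have "a * v * (- D) = (a * F) * (v * J - v * J0) - a * (v * J0) * J"
    by (simp add: D_def algebra_simps)
  also have "\<dots> = b * J\<^sup>2 + x * ((a + 1) * J\<^sup>2 - (b - 1) * J * M - x * J * M - x * M\<^sup>2)"
    unfolding aF vJ0 by (simp add: v_def b_def power2_eq_square algebra_simps)
  finally have key: "a * v * (- D)
      = b * J\<^sup>2 + x * ((a + 1) * J\<^sup>2 - (b - 1) * J * M - x * J * M - x * M\<^sup>2)" .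
  \<comment> \<open>The equation for \<open>x * (M + N)\<close> turns the bracket into
    \<open>x\<close> times the Cauchy-Schwarz defect \<open>J * N - M^2\<close>.\<close>
  have "(a + 1) * J\<^sup>2 - (b - 1) * J * M = J * (x * (M + N))"
    unfolding N by (simp add: b_def power2_eq_square algebra_simps)
  then have "a * v * (- D) = b * J\<^sup>2 + x\<^sup>2 * (J * N - M\<^sup>2)"
    unfolding key by (simp add: power2_eq_square algebra_simps)
  then have D_ge: "b * J\<^sup>2 \<le> a * v * (- D)"
    using turan by simp
  \<comment> \<open>For the opposite estimate the subtracted terms of \<open>key\<close> are
    dropped.\<close>
  have "0 \<le> x * ((b - 1) * J * M + x * J * M + x * M\<^sup>2)"
    using b J pos x by (intro add_nonneg_nonneg mult_nonneg_nonneg) auto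
  then have D_le: "a * v * (- D) \<le> (b + x * (a + 1)) * J\<^sup>2"
    unfolding key by (simp add: algebra_simps)

  \<comment> \<open>The relative error in \<open>a * F \<le> b * J * (1 + y)\<close>; the correction
    factor of the upper bound is \<open>1 - 2 * y\<close>.\<close>
  define y where "y = x * ((a + b) / (b * (b - 1)))"
  have y: "y > 0"
    using a b x by (simp add: y_def)
  have "N > 0"
    using turan pos J by (smt (verit, best) zero_less_power mult_nonneg_nonpos)
  \<comment> \<open>By the equation for \<open>x * (M + N)\<close>, this positivity gives
    \<open>(b - 1) * M < (a + 1) * J\<close>, which bounds \<open>M\<close> by a multiple of
    \<open>J\<close> because \<open>b > 1\<close>.\<close>
  then have "0 < x * (M + N)"
    using x pos by simp
  then have "(b - 1) * (J + M) \<le> (a + b) * J"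
    unfolding N by (simp add: b_def algebra_simps)
  then have "J + M \<le> (a + b) * J / (b - 1)"
    using b by (simp add: field_simps)
  then have "a * F \<le> b * J + x * ((a + b) * J / (b - 1))"
    unfolding aF using x by (intro add_left_mono mult_left_mono) auto
  also have "\<dots> = b * J * (1 + y)"
    using b by (simp add: y_def field_simps)
  finally have aF_le: "a * F \<le> b * J * (1 + y)" .
  have "(a * F)\<^sup>2 * (1 - 2 * y) < (b * J)\<^sup>2"
  \<comment> \<open>The squared estimate can be multiplied by \<open>1 - 2 * y\<close> only if that
    factor is nonnegative; otherwise the left side is at most 0 anyway.\<close>
  proof (cases "1 - 2 * y \<le> 0")
    case True
    then have "(a * F)\<^sup>2 * (1 - 2 * y) \<le> 0"
      by (intro mult_nonneg_nonpos) auto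
    also have "\<dots> < (b * J)\<^sup>2"
      using b J by simp
    finally show ?thesis .
  next
    case False
    then have "(a * F)\<^sup>2 * (1 - 2 * y) \<le> (b * J * (1 + y))\<^sup>2 * (1 - 2 * y)"
      using aF_le a pos by (intro mult_right_mono power_mono) auto
    also have "\<dots> = (b * J)\<^sup>2 * ((1 + y)\<^sup>2 * (1 - 2 * y))"
      by (simp add: power_mult_distrib)
    also have "\<dots> < (b * J)\<^sup>2 * 1"
      using b J cubic_less_one[OF y] by (intro mult_strict_left_mono) auto
    finally show ?thesis by simp
  qed
  also have "\<dots> = b * (b * J\<^sup>2)"
    by (simp add: power2_eq_square)
  also have "\<dots> \<le> b * (a * v * (- D))"
    using D_ge b by (intro mult_left_mono) auto
  finally have "a * (a * F\<^sup>2 * (1 - 2 * y)) < a * (b * v * (- D))"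
    by (simp add: power2_eq_square mult_ac)
  then have "a * F\<^sup>2 * (1 - 2 * y) < b * v * (- D)"
    using a by (simp only: mult_less_cancel_left_pos)
  then have "D < - (a / (b * v)) * (1 - 2 * y) * F\<^sup>2"
    using b v by (simp add: field_simps)
  moreover have "- (a / (b * v)) = a / (c * (1 + a - c))"
    by (simp add: b_def v_def)
  moreover have "1 - 2 * y = 1 + 2 * x * ((c - a) / (c * (c + 1)))"
    using c by (simp add: y_def b_def divide_simps algebra_simps)
  ultimately have "D < a / (c * (1 + a - c)) * (1 + 2 * x * ((c - a) / (c * (c + 1)))) * F\<^sup>2"
    by (simp only:)
  then have "g\<^sup>2 * D < g\<^sup>2 *
      (a / (c * (1 + a - c)) * (1 + 2 * x * ((c - a) / (c * (c + 1)))) * F\<^sup>2)"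
    using g by (intro mult_strict_left_mono) auto
  then show ?upper
    unfolding psi D by (simp add: power_mult_distrib mult_ac)

  \<comment> \<open>\<open>a * F\<close> exceeds \<open>b * J\<close> by \<open>x * (J + M)\<close>,
    so \<open>J\<close> in \<open>D_le\<close> can be traded for \<open>a * F / b\<close>.\<close>
  have "(b * J)\<^sup>2 \<le> (a * F)\<^sup>2"
    unfolding aF using b J x pos by (intro power_mono) auto
  then have "(b + x * (a + 1)) * (b * J)\<^sup>2 \<le> (b + x * (a + 1)) * (a * F)\<^sup>2"
    using a b x by (intro mult_left_mono) auto
  moreover have "b\<^sup>2 * (a * v * (- D)) \<le> b\<^sup>2 * ((b + x * (a + 1)) * J\<^sup>2)"
    using D_le by (intro mult_left_mono) auto
  ultimately have "a * (b\<^sup>2 * v * (- D)) \<le> a * ((b + x * (a + 1)) * a * F\<^sup>2)"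
    by (simp add: power_mult_distrib power2_eq_square mult_ac)
  then have "b\<^sup>2 * v * (- D) \<le> (b + x * (a + 1)) * a * F\<^sup>2"
    using a by (simp only: mult_le_cancel_left_pos)
  then have "- ((b + x * (a + 1)) * a * F\<^sup>2 / (b\<^sup>2 * v)) \<le> D"
    using b v by (simp add: divide_simps algebra_simps)
  also have "(b + x * (a + 1)) * a * F\<^sup>2 / (b\<^sup>2 * v) = a / (b * v) * (1 + x * ((a + 1) / b)) * F\<^sup>2"
    using b v by (simp add: field_simps power2_eq_square)
  finally have "g\<^sup>2 * (- (a / (b * v) * (1 + x * ((a + 1) / b)) * F\<^sup>2)) \<le> g\<^sup>2 * D"
    by (intro mult_left_mono) auto
  then show ?lower
    unfolding psi D by (simp add: b_def v_def power_mult_distrib mult_ac)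
qed

section \<open>Sharpness by squeezing\<close>

text \<open>The common limit is 0: after division the Turanian lies between
  \<open>- (a / x^2)\<close> and 0, by \<open>turanian_gt\<close> and
  \<open>turanian_nonpos\<close>.\<close>

lemma turanian_sharp_at_top:
  assumes "a > 0" "c < 1"
  shows "sharp_at at_top (\<lambda>x. (tricomi_psi a c x)\<^sup>2)
        (\<lambda>x. - (a / x\<^sup>2) * (tricomi_psi a c x)\<^sup>2) (turanian a c)"
  unfolding sharp_at_def
proof (intro exI[of _ 0] conjI)
  have psi: "(tricomi_psi a c x)\<^sup>2 > 0" if "x > 0" for x
    using tricomi_psi_pos[OF assms(1) that, of c] by simp
  have "((\<lambda>x::real. inverse x) \<longlongrightarrow> 0) at_top"
    by (rule tendsto_inverse_0_at_top[OF filterlim_ident])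
  from tendsto_mult[OF tendsto_const[of "- a"] tendsto_power[OF this, of 2]]
  have lim: "((\<lambda>x. - (a / x\<^sup>2)) \<longlongrightarrow> 0) at_top"
    by (simp add: field_simps)
  show "((\<lambda>x. - (a / x\<^sup>2) * (tricomi_psi a c x)\<^sup>2 / (tricomi_psi a c x)\<^sup>2) \<longlongrightarrow> 0) at_top"
    using lim
  proof (rule Lim_transform_eventually)
    show "\<forall>\<^sub>F x in at_top. - (a / x\<^sup>2)
        = - (a / x\<^sup>2) * (tricomi_psi a c x)\<^sup>2 / (tricomi_psi a c x)\<^sup>2"
      using eventually_gt_at_top[of 0] by eventually_elim (use psi in force)
  qed
  show "((\<lambda>x. turanian a c x / (tricomi_psi a c x)\<^sup>2) \<longlongrightarrow> 0) at_top"
  proof (rule tendsto_sandwich[OF _ _ lim tendsto_const])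
    show "\<forall>\<^sub>F x in at_top. - (a / x\<^sup>2) \<le> turanian a c x / (tricomi_psi a c x)\<^sup>2"
      using eventually_gt_at_top[of 0]
    proof eventually_elim
      case (elim x)
      show ?case
        using turanian_gt[OF assms elim] by (subst pos_le_divide_eq[OF psi[OF elim]]) simp
    qed
    show "\<forall>\<^sub>F x in at_top. turanian a c x / (tricomi_psi a c x)\<^sup>2 \<le> 0"
      using eventually_gt_at_top[of 0]
      by eventually_elim (simp add: divide_nonpos_nonneg turanian_nonpos assms)
  qed
qed

text \<open>After division the two bounds of \<open>turanian_bounds\<close> are affine in
  \<open>x\<close> with the same value \<open>a / (c * (1 + a - c))\<close> at 0, which is the
  common limit.\<close>

lemma turanian_sharp_at_right_0:
  assumes "a > 0" "c < -1"
  shows "sharp_at (at_right 0) (\<lambda>x. (tricomi_psi a c x)\<^sup>2) (turanian a c)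
        (\<lambda>x. a / (c * (1 + a - c)) * (1 + 2 * x * ((c - a) / (c * (c + 1)))) * (tricomi_psi a c x)\<^sup>2)"
  unfolding sharp_at_def
proof (intro exI[of _ "a / (c * (1 + a - c))"] conjI)
  let ?u = "\<lambda>x. a / (c * (1 + a - c)) * (1 + 2 * x * ((c - a) / (c * (c + 1))))"
  let ?l = "\<lambda>x. a / (c * (1 + a - c)) * (1 - x * ((a + 1) / c))"
  have psi: "(tricomi_psi a c x)\<^sup>2 > 0" if "x > 0" for x
    using tricomi_psi_pos[OF assms(1) that, of c] by simp
  have pos: "\<forall>\<^sub>F x in at_right 0. x > (0::real)"
    by (rule eventually_at_right_less)
  have "(?u \<longlongrightarrow> a / (c * (1 + a - c)) * (1 + 2 * 0 * ((c - a) / (c * (c + 1))))) (at_right 0)"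
    by (intro tendsto_mult tendsto_add tendsto_const tendsto_ident_at)
  then have lim_u: "(?u \<longlongrightarrow> a / (c * (1 + a - c))) (at_right 0)"
    by simp
  have "(?l \<longlongrightarrow> a / (c * (1 + a - c)) * (1 - 0 * ((a + 1) / c))) (at_right 0)"
    by (intro tendsto_mult tendsto_diff tendsto_const tendsto_ident_at)
  then have lim_l: "(?l \<longlongrightarrow> a / (c * (1 + a - c))) (at_right 0)"
    by simp
  show "((\<lambda>x. ?u x * (tricomi_psi a c x)\<^sup>2 / (tricomi_psi a c x)\<^sup>2)
      \<longlongrightarrow> a / (c * (1 + a - c))) (at_right 0)"
    using lim_u
  proof (rule Lim_transform_eventually)
    show "\<forall>\<^sub>F x in at_right 0. ?u x = ?u x * (tricomi_psi a c x)\<^sup>2 / (tricomi_psi a c x)\<^sup>2"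
      using pos by eventually_elim (use psi in force)
  qed
  show "((\<lambda>x. turanian a c x / (tricomi_psi a c x)\<^sup>2) \<longlongrightarrow> a / (c * (1 + a - c))) (at_right 0)"
  proof (rule tendsto_sandwich[OF _ _ lim_l lim_u])
    show "\<forall>\<^sub>F x in at_right 0. ?l x \<le> turanian a c x / (tricomi_psi a c x)\<^sup>2"
      using pos
    proof eventually_elim
      case (elim x)
      show ?case
        using turanian_bounds(2)[OF assms elim] by (subst pos_le_divide_eq[OF psi[OF elim]]) simp
    qed
    show "\<forall>\<^sub>F x in at_right 0. turanian a c x / (tricomi_psi a c x)\<^sup>2 \<le> ?u x"
      using pos
    proof eventually_elim
      case (elim x)
      show ?case
        using turanian_bounds(1)[OF assms elim] by (subst pos_divide_le_eq[OF psi[OF elim]]) simp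
    qed
  qed
qed

theorem theorem3:
  shows "(\<forall>a c x :: real. a > 0 \<and> c < 1 \<and> x > 0 \<longrightarrow>
      - (a / x\<^sup>2) * (tricomi_psi a c x)\<^sup>2
        < (tricomi_psi a c x)\<^sup>2 - tricomi_psi a (c - 1) x * tricomi_psi a (c + 1) x)
    \<and> (\<forall>a c x :: real. a > 1 \<and> c < - 1 \<and> x > 0 \<longrightarrow>
      (tricomi_psi a c x)\<^sup>2 - tricomi_psi a (c - 1) x * tricomi_psi a (c + 1) x
        < a / (c * (1 + a - c)) * (1 + 2 * x * ((c - a) / (c * (c + 1)))) * (tricomi_psi a c x)\<^sup>2)
    \<and> (\<forall>a c :: real. a > 0 \<and> c < 1 \<longrightarrow>
      sharp_at at_top (\<lambda>x. (tricomi_psi a c x)\<^sup>2)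
        (\<lambda>x. - (a / x\<^sup>2) * (tricomi_psi a c x)\<^sup>2)
        (\<lambda>x. (tricomi_psi a c x)\<^sup>2 - tricomi_psi a (c - 1) x * tricomi_psi a (c + 1) x))
    \<and> (\<forall>a c :: real. a > 1 \<and> c < - 1 \<longrightarrow>
      sharp_at (at_right 0) (\<lambda>x. (tricomi_psi a c x)\<^sup>2)
        (\<lambda>x. (tricomi_psi a c x)\<^sup>2 - tricomi_psi a (c - 1) x * tricomi_psi a (c + 1) x)
        (\<lambda>x. a / (c * (1 + a - c)) * (1 + 2 * x * ((c - a) / (c * (c + 1)))) * (tricomi_psi a c x)\<^sup>2))"
  using turanian_gt turanian_bounds(1) turanian_sharp_at_top turanian_sharp_at_right_0
  unfolding turanian_def[abs_def] by auto

end
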